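(* Let $n$ be any nonnegative integer. Then, as polynomial identities in $x$, $$(n+2)\sum_{k=0}^nE_k(x)E_{n-k}(x)=8\sum_{l=2}^{n+2}\binom{n+2}{l}(2^{l}-1)\frac{B_l}{l}B_{n+2-l}(x),$$ $$\sum_{k=1}^n\frac{B_k(x)}{k}E_{n-k}(x)-\sum_{l=2}^n\binom{n}{l}2^l\frac{B_l}{l}E_{n-l}(x)=H_nE_n(x),$$ and $$\sum_{k=0}^nB_k(x)E_{n-k}(x)-\sum_{l=2}^n\binom{n+1}{l+1}(2^l+l-1)\frac{B_l}{l}E_{n-l}(x)=(n+1)E_n(x).$$
   Context: The Bernoulli numbers $B_0,B_1,\ldots$ are defined by $\frac{z}{e^z-1}=\sum_{n=0}^{\infty}B_n\frac{z^n}{n!}$ for $|z|<2\pi$ (so $B_1=-1/2$). The Bernoulli polynomials are $B_n(x)=\sum_{k=0}^n\binom{n}{k}B_kx^{n-k}$ for $n=0,1,2,\ldots$; here $B_l$ without an argument denotes the Bernoulli number. The Euler polynomials $E_n(x)$ ($n=0,1,2,\ldots$) are defined by $\frac{2e^{xz}}{e^z+1}=\sum_{n=0}^{\infty}E_n(x)\frac{z^n}{n!}$. $H_n=\sum_{k=1}^n\frac1k$ (so $H_0=0$). Empty sums are $0$. *)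

theory Defs
  imports "HOL-Complex_Analysis.Complex_Analysis"
begin

(* The generating functions are read as formal power series; the quotient fps_X / (fps_exp 1 - 1)
   is exact although the divisor has no constant term. *)
definition bernoulli_num :: "nat \<Rightarrow> complex" where
  "bernoulli_num n = fact n * fps_nth (fps_X / (fps_exp 1 - 1)) n"

definition bernoulli_poly :: "nat \<Rightarrow> complex poly" where
  "bernoulli_poly n = (\<Sum>k\<le>n. monom (of_nat (n choose k) * bernoulli_num k) (n - k))"

(* 2 * exp (x * z) / (exp z + 1) as a power series in z whose coefficients are polynomials in x:
   the quotient 2 / (exp z + 1) is taken over the complex numbers (polynomials do not form a field)
   and its coefficients are embedded as constant polynomials; the second factor is exp (x * z). *)
definition euler_poly_gf :: "complex poly fps" where
  "euler_poly_gf =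
     Abs_fps (\<lambda>n. [:fps_nth (2 / (fps_exp 1 + 1)) n:]) * Abs_fps (\<lambda>n. monom (1 / fact n) n)"

definition euler_poly :: "nat \<Rightarrow> complex poly" where
  "euler_poly n = smult (fact n) (fps_nth euler_poly_gf n)"


(* bernoulli_num satisfies the analytic definition; the value at 0 is the removable one. *)
lemma bernoulli_num_sums:
  fixes z :: complex
  assumes "norm z < 2 * pi"
  shows "(\<lambda>n. bernoulli_num n * z ^ n / fact n) sums (if z = 0 then 1 else z / (exp z - 1))"
proof -
  define f where "f = (fps_X :: complex fps)"
  define g where "g = (fps_exp 1 - 1 :: complex fps)"
  have g1: "fps_nth g 1 = 1" and g0: "fps_nth g 0 = 0"
    by (simp_all add: g_def)
  have sub: "subdegree g = 1"
    by (rule subdegreeI) (use g0 g1 in auto)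
  have conv_g: "fps_conv_radius g = \<infinity>"
  proof -
    have "min (fps_conv_radius (fps_exp 1 :: complex fps)) (fps_conv_radius (1 :: complex fps))
            \<le> fps_conv_radius g"
      unfolding g_def by (rule fps_conv_radius_diff)
    thus ?thesis by simp
  qed
  have eval_g: "eval_fps g w = exp w - 1" for w
    unfolding g_def by (subst eval_fps_diff) auto
  have nz: "eval_fps g w \<noteq> 0" if "w \<in> eball 0 (ereal (2 * pi))" "w \<noteq> 0" for w
  proof
    assume "eval_fps g w = 0"
    hence "exp w = 1" by (simp add: eval_g)
    then obtain n :: int where n: "Re w = 0" "Im w = of_int (2 * n) * pi"
      by (auto simp: exp_eq_1)
    hence "n \<noteq> 0" using that(2) by (auto simp: complex_eq_iff)
    hence "\<bar>real_of_int n\<bar> \<ge> 1" by linarith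
    hence "2 * pi \<le> \<bar>Im w\<bar>" by (simp add: n abs_mult)
    also have "\<dots> \<le> norm w" by (rule abs_Im_le_cmod)
    finally show False using that(1) by simp
  qed
  have rad: "ereal (2 * pi) \<le> fps_conv_radius (f / g)"
  proof -
    have "Min {ereal (2 * pi), fps_conv_radius f, fps_conv_radius g} \<le> fps_conv_radius (f / g)"
      by (rule fps_conv_radius_divide) (use nz sub conv_g g1 in \<open>auto simp: f_def\<close>)
    thus ?thesis by (simp add: conv_g f_def)
  qed
  have "eval_fps (f / g) z = (if z = 0 then 1 else eval_fps f z / eval_fps g z)"
    by (rule eval_fps_divide[where r = "ereal (2 * pi)"])
       (use nz sub conv_g g1 assms in \<open>auto simp: f_def\<close>)
  hence eval: "eval_fps (f / g) z = (if z = 0 then 1 else z / (exp z - 1))"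
    by (simp add: eval_g f_def)
  have "ereal (norm z) < ereal (2 * pi)" using assms by simp
  also note rad
  finally have "(\<lambda>n. fps_nth (f / g) n * z ^ n) sums eval_fps (f / g) z"
    by (rule sums_eval_fps)
  thus ?thesis
    unfolding eval by (simp add: bernoulli_num_def f_def g_def)
qed

lemma poly_euler_poly:
  "poly (euler_poly n) x = fact n * fps_nth (2 * fps_exp x / (fps_exp 1 + 1)) n"
proof -
  have nz: "fps_nth (fps_exp 1 + 1 :: complex fps) 0 \<noteq> 0" by simp
  have "2 * fps_exp x / (fps_exp 1 + 1) = 2 / (fps_exp 1 + 1) * fps_exp x"
    using nz by (simp add: fps_divide_unit mult_ac)
  thus ?thesis
    by (simp add: euler_poly_def euler_poly_gf_def fps_mult_nth poly_sum poly_monom)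
qed

end

theory Submission
  imports Defs
begin

text \<open>
  The proof compares finite differences in \<open>x\<close>, using
  \<open>E\<^sub>n(x + 1) + E\<^sub>n(x) = 2 x\<^sup>n\<close> and
  \<open>B\<^sub>n(x + 1) - B\<^sub>n(x) = n x\<^sup>n\<^sup>-\<^sup>1\<close>
  (\<open>euler_poly_plus_1\<close>, \<open>bernoulli_poly_plus_1\<close>). For a product \<open>f\<close> of two Euler
  polynomials, \<open>f(x + 1) - f(x)\<close> has no product of two such polynomials left, only powers of
  \<open>x\<close> and their multiples by a single polynomial; so has \<open>f(x + 1) + f(x)\<close> for a product
  of a Bernoulli and an Euler polynomial. Since \<open>B\<^sub>n\<close> and \<open>E\<^sub>n\<close> are both Appell polynomials
  \<open>\<Sum>k\<le>n. (n choose k) c\<^sub>k x\<^sup>n\<^sup>-\<^sup>k\<close>, sums of the form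
  \<open>\<Sum>k\<le>n. x\<^sup>n\<^sup>-\<^sup>k A\<^sub>k(x)\<close>, possibly weighted by \<open>n + 1 - k\<close> or
  \<open>1 / k\<close>, are evaluated coefficientwise by hockey-stick identities for binomial coefficients
  (\<open>sum_power_appell\<close>, \<open>sum_weighted_power_appell\<close>, \<open>sum_power_appell_over_index\<close>).
  The values \<open>E\<^sub>j(0)\<close> that appear are turned into Bernoulli numbers by
  \<open>E\<^sub>j(0) = -2 (2\<^sup>j\<^sup>+\<^sup>1 - 1) B\<^sub>j\<^sub>+\<^sub>1 / (j + 1)\<close> (\<open>euler_zero_eq\<close>).

  For the two identities mixing \<open>B\<close> and \<open>E\<close>, both sides have the same image under the operator
  \<open>f(x) \<mapsto> f(x + 1) + f(x)\<close>, which is injective on polynomials. For the identity on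
  \<open>\<Sum>k\<le>n. E\<^sub>k E\<^sub>n\<^sub>-\<^sub>k\<close>, both sides have the same difference
  \<open>f(x + 1) - f(x)\<close>, so their difference \<open>D\<^sub>n\<close> is constant. The constant vanishes because
  \<open>D\<^sub>n\<^sub>+\<^sub>1' = (n + 3) D\<^sub>n\<close> and \<open>D\<^sub>n\<^sub>+\<^sub>1\<close> is constant as well.
\<close>

section \<open>Appell polynomials\<close>

text \<open>The Appell polynomials with constant terms \<open>c\<close>: their exponential generating function is
  that of \<open>c\<close> times \<open>exp (x z)\<close>.\<close>
definition appell_poly :: "(nat \<Rightarrow> complex) \<Rightarrow> nat \<Rightarrow> complex poly" where
  "appell_poly c n = (\<Sum>k\<le>n. monom (of_nat (n choose k) * c k) (n - k))"

lemma poly_appell: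
  "poly (appell_poly c n) x = (\<Sum>k\<le>n. of_nat (n choose k) * c k * x ^ (n - k))"
  by (simp add: appell_poly_def poly_sum poly_monom)

lemma poly_appell_egf:
  "poly (appell_poly c n) x = fact n * fps_nth (Abs_fps (\<lambda>k. c k / fact k) * fps_exp x) n"
  unfolding poly_appell fps_mult_nth atLeast0AtMost sum_distrib_left
  by (rule sum.cong) (auto simp: binomial_fact)

lemma pderiv_sum: "pderiv (sum f A) = (\<Sum>x\<in>A. pderiv (f x))"
  using higher_pderiv_sum[of 1 f A] by simp

lemma pderiv_appell:
  "pderiv (appell_poly c (Suc n)) = smult (of_nat (Suc n)) (appell_poly c n)"
proof (rule poly_ext)
  fix x
  have "poly (pderiv (appell_poly c (Suc n))) x
      = (\<Sum>k\<le>Suc n. of_nat (Suc n - k) * (of_nat (Suc n choose k) * c k) * x ^ (n - k))"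
    unfolding appell_poly_def
    by (simp add: pderiv_sum pderiv_monom poly_sum poly_monom del: binomial_Suc_Suc sum.atMost_Suc)
  also have "\<dots> = (\<Sum>k\<le>n. of_nat (Suc n - k) * (of_nat (Suc n choose k) * c k) * x ^ (n - k))"
    by simp
  also have "\<dots> = (\<Sum>k\<le>n. of_nat (Suc n) * (of_nat (n choose k) * c k * x ^ (n - k)))"
  proof (rule sum.cong[OF refl])
    fix k assume "k \<in> {..n}"
    hence "(Suc n - k) * (Suc n choose k) = Suc n * (n choose k)"
      using binomial_absorb_comp[of "Suc n" k] by simp
    hence "of_nat (Suc n - k) * of_nat (Suc n choose k) = (of_nat (Suc n) * of_nat (n choose k) :: complex)"
      by (metis of_nat_mult)
    thus "of_nat (Suc n - k) * (of_nat (Suc n choose k) * c k) * x ^ (n - k) =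
          of_nat (Suc n) * (of_nat (n choose k) * c k * x ^ (n - k))"
      by (metis mult.assoc)
  qed
  also have "\<dots> = poly (smult (of_nat (Suc n)) (appell_poly c n)) x"
    by (simp add: poly_appell sum_distrib_left)
  finally show "poly (pderiv (appell_poly c (Suc n))) x = poly (smult (of_nat (Suc n)) (appell_poly c n)) x" .
qed

section \<open>Sums of Appell polynomials against powers\<close>

lemma sum_power_Suc:
  fixes f :: "nat \<Rightarrow> complex"
  shows "(\<Sum>k\<le>Suc m. x ^ (Suc m - k) * f k) = x * (\<Sum>k\<le>m. x ^ (m - k) * f k) + f (Suc m)"
proof -
  have "(\<Sum>k\<le>m. x ^ (Suc m - k) * f k) = x * (\<Sum>k\<le>m. x ^ (m - k) * f k)"
    unfolding sum_distrib_left by (rule sum.cong) (auto simp: Suc_diff_le)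
  thus ?thesis by simp
qed

text \<open>For \<open>r = 0\<close> the inner sum is an Appell polynomial; the general \<open>r\<close> makes the
  identity iterable. In the induction step the coefficients combine by Pascal's rule.\<close>
lemma hockey_stick_sum:
  fixes c :: "nat \<Rightarrow> complex"
  shows "(\<Sum>k\<le>m. x ^ (m - k) * (\<Sum>j\<le>k. of_nat ((k + r) choose (j + r)) * c j * x ^ (k - j)))
       = (\<Sum>j\<le>m. of_nat ((m + r + 1) choose (j + r + 1)) * c j * x ^ (m - j))"
proof (induction m)
  case 0
  show ?case by simp
next
  case (Suc m)
  let ?f = "\<lambda>k. \<Sum>j\<le>k. of_nat ((k + r) choose (j + r)) * c j * x ^ (k - j)"
  have "(\<Sum>k\<le>Suc m. x ^ (Suc m - k) * ?f k) = x * (\<Sum>k\<le>m. x ^ (m - k) * ?f k) + ?f (Suc m)"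
    by (rule sum_power_Suc)
  also have "\<dots> = x * (\<Sum>j\<le>m. of_nat ((m + r + 1) choose (j + r + 1)) * c j * x ^ (m - j)) + ?f (Suc m)"
    by (simp only: Suc.IH)
  also have "x * (\<Sum>j\<le>m. of_nat ((m + r + 1) choose (j + r + 1)) * c j * x ^ (m - j))
      = (\<Sum>j\<le>Suc m. of_nat ((m + r + 1) choose (j + r + 1)) * c j * x ^ (Suc m - j))"
    using sum_power_Suc[of x m "\<lambda>j. of_nat ((m + r + 1) choose (j + r + 1)) * c j"]
    by (simp add: mult_ac del: binomial_Suc_Suc sum.atMost_Suc)
  also have "\<dots> + ?f (Suc m) = (\<Sum>j\<le>Suc m. of_nat ((Suc m + r + 1) choose (j + r + 1)) * c j * x ^ (Suc m - j))"
    unfolding sum.distrib[symmetric] by (rule sum.cong) (simp_all add: algebra_simps)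
  finally show ?case .
qed

lemma sum_power_appell:
  "(\<Sum>k\<le>m. x ^ (m - k) * poly (appell_poly c k) x)
     = (\<Sum>j\<le>m. of_nat ((m + 1) choose (j + 1)) * c j * x ^ (m - j))"
  using hockey_stick_sum[of x m 0 c] by (simp add: poly_appell)

lemma sum_weighted_power_appell:
  "(\<Sum>k\<le>m. of_nat (m + 1 - k) * x ^ (m - k) * poly (appell_poly c k) x)
     = (\<Sum>j\<le>m. of_nat ((m + 2) choose (j + 2)) * c j * x ^ (m - j))"
proof -
  let ?A = "\<lambda>k. poly (appell_poly c k) x"
  \<comment> \<open>The weight \<open>m + 1 - k\<close> counts the outer indices whose inner sum contains the \<open>k\<close>-th term,
      so two applications of the hockey-stick identity suffice.\<close>
  have "(\<Sum>k\<le>m. of_nat (m + 1 - k) * x ^ (m - k) * ?A k)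
      = (\<Sum>k\<le>m. x ^ (m - k) * (\<Sum>i\<le>k. x ^ (k - i) * ?A i))"
  proof (induction m)
    case 0
    show ?case by simp
  next
    case (Suc m)
    have "(\<Sum>k\<le>Suc m. of_nat (Suc m + 1 - k) * x ^ (Suc m - k) * ?A k)
        = (\<Sum>k\<le>Suc m. of_nat (Suc m - k) * x ^ (Suc m - k) * ?A k) + (\<Sum>k\<le>Suc m. x ^ (Suc m - k) * ?A k)"
      unfolding sum.distrib[symmetric]
      by (rule sum.cong) (auto simp: Suc_diff_le algebra_simps)
    also have "(\<Sum>k\<le>Suc m. of_nat (Suc m - k) * x ^ (Suc m - k) * ?A k)
        = x * (\<Sum>k\<le>m. of_nat (m + 1 - k) * x ^ (m - k) * ?A k)"
    proof -
      have "(\<Sum>k\<le>m. of_nat (Suc m - k) * x ^ (Suc m - k) * ?A k)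
          = (\<Sum>k\<le>m. x * (of_nat (m + 1 - k) * x ^ (m - k) * ?A k))"
        by (rule sum.cong) (auto simp: Suc_diff_le mult_ac)
      thus ?thesis by (simp add: sum_distrib_left)
    qed
    also note Suc.IH
    also have "x * (\<Sum>k\<le>m. x ^ (m - k) * (\<Sum>i\<le>k. x ^ (k - i) * ?A i)) + (\<Sum>k\<le>Suc m. x ^ (Suc m - k) * ?A k)
       = (\<Sum>k\<le>Suc m. x ^ (Suc m - k) * (\<Sum>i\<le>k. x ^ (k - i) * ?A i))"
      by (rule sum_power_Suc[symmetric])
    finally show ?case .
  qed
  also have "\<dots> = (\<Sum>k\<le>m. x ^ (m - k) * (\<Sum>j\<le>k. of_nat ((k + 1) choose (j + 1)) * c j * x ^ (k - j)))"
    by (simp only: sum_power_appell)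
  also have "\<dots> = (\<Sum>j\<le>m. of_nat ((m + 1 + 1) choose (j + 1 + 1)) * c j * x ^ (m - j))"
    by (rule hockey_stick_sum)
  finally show ?thesis by simp
qed

lemma sum_power_appell_over_index:
  "(\<Sum>k=1..n. x ^ (n - k) * poly (appell_poly c k) x / of_nat k)
     = c 0 * harm n * x ^ n + (\<Sum>l=1..n. of_nat (n choose l) * (c l / of_nat l) * x ^ (n - l))"
proof (induction n)
  case 0
  show ?case by (simp add: harm_def)
next
  case (Suc n)
  let ?A = "\<lambda>k. poly (appell_poly c k) x"
  have "(\<Sum>k=1..Suc n. x ^ (Suc n - k) * ?A k / of_nat k)
      = x * (\<Sum>k=1..n. x ^ (n - k) * ?A k / of_nat k) + ?A (Suc n) / of_nat (Suc n)"
  proof -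
    have "(\<Sum>k=1..n. x ^ (Suc n - k) * ?A k / of_nat k) = (\<Sum>k=1..n. x * (x ^ (n - k) * ?A k / of_nat k))"
      by (rule sum.cong) (auto simp: Suc_diff_le)
    thus ?thesis by (simp add: sum_distrib_left)
  qed
  also have "x * (\<Sum>k=1..n. x ^ (n - k) * ?A k / of_nat k) =
      c 0 * harm n * x ^ Suc n + (\<Sum>l=1..Suc n. of_nat (n choose l) * (c l / of_nat l) * x ^ (Suc n - l))"
  proof -
    have "(\<Sum>l=1..n. of_nat (n choose l) * (c l / of_nat l) * x ^ (Suc n - l))
        = (\<Sum>l=1..n. x * (of_nat (n choose l) * (c l / of_nat l) * x ^ (n - l)))"
      by (rule sum.cong) (auto simp: Suc_diff_le)
    thus ?thesis unfolding Suc.IH by (simp add: sum_distrib_left distrib_left mult_ac)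
  qed
  also have "?A (Suc n) / of_nat (Suc n) = c 0 * x ^ Suc n / of_nat (Suc n) +
       (\<Sum>l=1..Suc n. of_nat (Suc n choose l) * c l * x ^ (Suc n - l) / of_nat (Suc n))"
  proof -
    have "{..Suc n} = insert 0 {1..Suc n}" by auto
    thus ?thesis
      unfolding poly_appell
      by (simp add: add_divide_distrib sum_divide_distrib del: binomial_Suc_Suc of_nat_Suc sum.cl_ivl_Suc)
  qed
  also have "(\<Sum>l=1..Suc n. of_nat (Suc n choose l) * c l * x ^ (Suc n - l) / of_nat (Suc n))
     = (\<Sum>l=1..Suc n. of_nat (n choose (l - 1)) * (c l / of_nat l) * x ^ (Suc n - l))"
  proof (rule sum.cong[OF refl])
    fix l assume l: "l \<in> {1..Suc n}"
    then obtain j where j: "l = Suc j" by (cases l) auto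
    have "of_nat (Suc j) * of_nat (Suc n choose Suc j) = (of_nat (Suc n) * of_nat (n choose j) :: complex)"
      using Suc_times_binomial_eq[of n j] by (metis mult.commute of_nat_mult)
    hence "of_nat (Suc n choose l) / of_nat (Suc n) = (of_nat (n choose (l - 1)) / of_nat l :: complex)"
      unfolding j by (simp add: field_simps del: of_nat_Suc binomial_Suc_Suc)
    thus "of_nat (Suc n choose l) * c l * x ^ (Suc n - l) / of_nat (Suc n)
        = of_nat (n choose (l - 1)) * (c l / of_nat l) * x ^ (Suc n - l)"
      by (metis (no_types, lifting) times_divide_eq_left times_divide_eq_right)
  qed
  also have "c 0 * harm n * x ^ Suc n + (\<Sum>l=1..Suc n. of_nat (n choose l) * (c l / of_nat l) * x ^ (Suc n - l))
       + (c 0 * x ^ Suc n / of_nat (Suc n) + (\<Sum>l=1..Suc n. of_nat (n choose (l - 1)) * (c l / of_nat l) * x ^ (Suc n - l)))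
     = c 0 * harm (Suc n) * x ^ Suc n + ((\<Sum>l=1..Suc n. of_nat (n choose l) * (c l / of_nat l) * x ^ (Suc n - l))
       + (\<Sum>l=1..Suc n. of_nat (n choose (l - 1)) * (c l / of_nat l) * x ^ (Suc n - l)))"
    by (simp add: harm_Suc algebra_simps divide_inverse del: of_nat_Suc sum.cl_ivl_Suc power_Suc)
  also have "(\<Sum>l=1..Suc n. of_nat (n choose l) * (c l / of_nat l) * x ^ (Suc n - l))
       + (\<Sum>l=1..Suc n. of_nat (n choose (l - 1)) * (c l / of_nat l) * x ^ (Suc n - l))
       = (\<Sum>l=1..Suc n. of_nat (Suc n choose l) * (c l / of_nat l) * x ^ (Suc n - l))"
    unfolding sum.distrib[symmetric]
  proof (rule sum.cong[OF refl])
    fix l assume l: "l \<in> {1..Suc n}"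
    then obtain j where j: "l = Suc j" by (cases l) auto
    show "of_nat (n choose l) * (c l / of_nat l) * x ^ (Suc n - l) +
          of_nat (n choose (l - 1)) * (c l / of_nat l) * x ^ (Suc n - l)
        = of_nat (Suc n choose l) * (c l / of_nat l) * x ^ (Suc n - l)"
      unfolding j by (simp add: algebra_simps del: of_nat_Suc)
  qed
  finally show ?case .
qed

section \<open>Bernoulli and Euler polynomials\<close>

lemma bernoulli_poly_eq_appell: "bernoulli_poly = appell_poly bernoulli_num"
  by (simp add: fun_eq_iff bernoulli_poly_def appell_poly_def)

text \<open>The constant terms \<open>E\<^sub>n(0)\<close>, which differ from the classical Euler numbers
  \<open>2\<^sup>n E\<^sub>n(1/2)\<close>.\<close>
definition euler_zero :: "nat \<Rightarrow> complex" where
  "euler_zero n = poly (euler_poly n) 0"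

lemma euler_zero_egf: "Abs_fps (\<lambda>k. euler_zero k / fact k) = 2 / (fps_exp 1 + 1)"
  by (rule fps_ext) (simp add: euler_zero_def poly_euler_poly)

lemma euler_poly_eq_appell: "euler_poly = appell_poly euler_zero"
proof (intro ext poly_ext)
  fix n x
  have "2 * fps_exp x / (fps_exp 1 + 1) = 2 / (fps_exp 1 + 1) * (fps_exp x :: complex fps)"
    by (simp add: fps_divide_unit mult_ac)
  thus "poly (euler_poly n) x = poly (appell_poly euler_zero n) x"
    by (simp add: poly_euler_poly poly_appell_egf euler_zero_egf)
qed

text \<open>Both \<open>fps_X\<close> and \<open>fps_exp 1 - 1\<close> have subdegree 1, so the quotient that defines the
  Bernoulli numbers is exact.\<close>
lemma bernoulli_gf_times: "fps_X / (fps_exp 1 - 1) * (fps_exp 1 - 1) = (fps_X :: complex fps)"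
proof -
  have "subdegree (fps_exp 1 - 1 :: complex fps) = 1"
    by (rule subdegreeI) auto
  hence "(fps_exp 1 - 1) dvd (fps_X :: complex fps)"
    by (subst fps_dvd_iff) auto
  thus ?thesis by (rule dvd_div_mult_self)
qed

lemma bernoulli_num_egf: "Abs_fps (\<lambda>k. bernoulli_num k / fact k) = fps_X / (fps_exp 1 - 1)"
  by (rule fps_ext) (simp add: bernoulli_num_def)

lemma euler_poly_plus_1:
  "poly (euler_poly n) (x + 1) = 2 * x ^ n - poly (euler_poly n) x"
proof -
  have "2 / (fps_exp 1 + 1) * fps_exp (x + 1) + 2 / (fps_exp 1 + 1) * fps_exp x
     = (2 / (fps_exp 1 + 1) * (fps_exp 1 + 1)) * (fps_exp x :: complex fps)"
    by (simp add: fps_exp_add_mult algebra_simps)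
  also have "2 / (fps_exp 1 + 1) * (fps_exp 1 + 1) = (2 :: complex fps)"
    by (simp add: fps_divide_unit inverse_mult_eq_1 mult.assoc)
  finally have "fps_nth (2 / (fps_exp 1 + 1) * fps_exp (x + 1)) n + fps_nth (2 / (fps_exp 1 + 1) * fps_exp x) n
     = fps_nth (2 * fps_exp x) n"
    by (metis fps_add_nth)
  thus ?thesis unfolding eq_diff_eq
    by (simp add: euler_poly_eq_appell poly_appell_egf euler_zero_egf numeral_fps_const flip: distrib_left)
qed

lemma bernoulli_poly_plus_1:
  "poly (bernoulli_poly n) (x + 1) = poly (bernoulli_poly n) x + of_nat n * x ^ (n - 1)"
proof -
  have "fps_X / (fps_exp 1 - 1) * fps_exp (x + 1) - fps_X / (fps_exp 1 - 1) * fps_exp x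
     = (fps_X / (fps_exp 1 - 1) * (fps_exp 1 - 1)) * (fps_exp x :: complex fps)"
    by (simp add: fps_exp_add_mult algebra_simps)
  also note bernoulli_gf_times
  finally have "fps_nth (fps_X / (fps_exp 1 - 1) * fps_exp (x + 1)) n - fps_nth (fps_X / (fps_exp 1 - 1) * fps_exp x) n
     = fps_nth (fps_X * fps_exp x) n"
    by (metis fps_sub_nth)
  hence "poly (bernoulli_poly n) (x + 1) - poly (bernoulli_poly n) x = fact n * fps_nth (fps_X * fps_exp x) n"
    by (simp add: bernoulli_poly_eq_appell poly_appell_egf bernoulli_num_egf flip: right_diff_distrib)
  thus ?thesis
    by (cases n) (auto simp: algebra_simps)
qed

text \<open>This compares coefficients in
  \<open>z \<cdot> 2 / (e\<^sup>z + 1) = 2 z / (e\<^sup>z - 1) - 2 \<cdot> 2 z / (e\<^sup>2\<^sup>z - 1)\<close>.\<close>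
lemma euler_zero_bernoulli:
  "euler_zero j * of_nat (Suc j) = 2 * (1 - 2 ^ Suc j) * bernoulli_num (Suc j)"
proof -
  define Q where "Q = (fps_X / (fps_exp 1 - 1) :: complex fps)"
  \<comment> \<open>\<open>R\<close> is \<open>Q\<close> at \<open>2 z\<close>, that is, \<open>2 z / (exp (2 z) - 1)\<close>.\<close>
  define R where "R = Abs_fps (\<lambda>n. 2 ^ n * fps_nth Q n)"
  define G where "G = (2 / (fps_exp 1 + 1) :: complex fps)"
  let ?e = "fps_exp 1 :: complex fps"
  have Q: "Q * (?e - 1) = fps_X" unfolding Q_def by (rule bernoulli_gf_times)
  have R': "R = Q oo (fps_const 2 * fps_X)"
    by (simp add: R_def fps_compose_linear)
  have "R * ((?e - 1) oo (fps_const 2 * fps_X)) = fps_X oo (fps_const 2 * fps_X)"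
    unfolding R' Q[symmetric] by (subst fps_compose_mult_distrib) auto
  hence R: "R * (fps_exp 2 - 1) = 2 * fps_X"
    by (simp add: fps_compose_sub_distrib numeral_fps_const)
  have e2: "fps_exp 2 = ?e * ?e"
    using fps_exp_add_mult[of 1 "1::complex"] by simp
  have G: "G * (?e + 1) = 2"
    unfolding G_def by (simp add: fps_divide_unit inverse_mult_eq_1 mult.assoc)
  have nz: "(?e - 1) * (?e + 1) \<noteq> 0"
  proof -
    have "fps_nth (?e + 1) 0 \<noteq> 0" by simp
    hence "?e + 1 \<noteq> 0" by (metis fps_zero_nth)
    thus ?thesis by simp
  qed
  have "(fps_X * G) * ((?e - 1) * (?e + 1)) = (2 * Q - 2 * R) * ((?e - 1) * (?e + 1))"
  proof -
    have "(fps_X * G) * ((?e - 1) * (?e + 1)) = fps_X * (G * (?e + 1)) * (?e - 1)"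
      by (simp only: mult_ac)
    also have "\<dots> = 2 * fps_X * (?e + 1) - 2 * (2 * fps_X)"
      unfolding G by (simp add: algebra_simps)
    also have "\<dots> = 2 * (Q * (?e - 1)) * (?e + 1) - 2 * (R * (fps_exp 2 - 1))"
      unfolding Q R by simp
    also have "\<dots> = (2 * Q - 2 * R) * ((?e - 1) * (?e + 1))"
      unfolding e2 by (simp add: algebra_simps)
    finally show ?thesis .
  qed
  hence "fps_X * G = 2 * Q - 2 * R" using nz by simp
  hence "fps_nth (fps_X * G) (Suc j) = fps_nth (2 * Q - 2 * R) (Suc j)" by simp
  hence "fps_nth G j = 2 * fps_nth Q (Suc j) - 2 * (2 ^ Suc j * fps_nth Q (Suc j))"
    by (simp add: numeral_fps_const R_def)
  moreover have "euler_zero j = fact j * fps_nth G j"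
    unfolding G_def euler_zero_egf[symmetric] by simp
  moreover have "bernoulli_num (Suc j) = fact j * of_nat (Suc j) * fps_nth Q (Suc j)"
    by (simp add: bernoulli_num_def Q_def)
  ultimately have "euler_zero j * of_nat (Suc j)
      = fact j * of_nat (Suc j) * (2 * fps_nth Q (Suc j) - 2 * (2 ^ Suc j * fps_nth Q (Suc j)))"
    by (simp only: mult_ac)
  thus ?thesis
    unfolding \<open>bernoulli_num (Suc j) = _\<close> by (simp add: ring_distribs mult_ac del: of_nat_Suc)
qed

lemma bernoulli_num_0: "bernoulli_num 0 = 1"
  and bernoulli_num_1: "bernoulli_num (Suc 0) = - 1 / 2"
proof -
  let ?Q = "fps_X / (fps_exp 1 - 1) :: complex fps"
  have "fps_nth (?Q * (fps_exp 1 - 1)) 1 = 1" "fps_nth (?Q * (fps_exp 1 - 1)) 2 = 0"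
    unfolding bernoulli_gf_times by simp_all
  thus "bernoulli_num 0 = 1" "bernoulli_num (Suc 0) = - 1 / 2"
    by (simp_all add: bernoulli_num_def fps_mult_nth numeral_2_eq_2 field_simps add_eq_0_iff)
qed

lemma euler_zero_0: "euler_zero 0 = 1"
  using euler_zero_bernoulli[of 0] by (simp add: bernoulli_num_1)

lemma euler_zero_eq:
  "euler_zero j = - 2 * (2 ^ Suc j - 1) * (bernoulli_num (Suc j) / of_nat (Suc j))"
  using euler_zero_bernoulli[of j] by (simp add: field_simps del: of_nat_Suc)

section \<open>Recovering polynomials from shifts\<close>

lemma constant_if_shift_invariant:
  fixes p :: "complex poly"
  assumes "a \<noteq> 0" and "\<And>x. poly p (x + a) = poly p x"
  shows "p = [:poly p 0:]"
proof (rule ccontr)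
  assume "p \<noteq> [:poly p 0:]"
  hence fin: "finite {x. poly (p - [:poly p 0:]) x = 0}"
    by (intro poly_roots_finite) auto
  have "poly p (of_nat k * a) = poly p 0" for k
  proof (induction k)
    case (Suc k)
    thus ?case using assms(2)[of "of_nat k * a"] by (simp add: algebra_simps)
  qed simp
  hence "range (\<lambda>k. of_nat k * a) \<subseteq> {x. poly (p - [:poly p 0:]) x = 0}"
    by auto
  hence "finite (range (\<lambda>k. of_nat k * a))" using fin by (rule finite_subset)
  moreover have "inj (\<lambda>k::nat. of_nat k * a)" using assms(1) by (auto intro!: injI)
  ultimately show False using finite_imageD infinite_UNIV_nat by blast
qed

text \<open>If \<open>d(x + 1) = - d(x)\<close>, then \<open>d\<close> has period 2, so it is a constant that equals its
  own negative.\<close>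
lemma poly_eqI_shift_sum:
  fixes p q :: "complex poly"
  assumes "\<And>x. poly p (x + 1) + poly p x = poly q (x + 1) + poly q x"
  shows "p = q"
proof -
  define d where "d = p - q"
  have d: "poly d (x + 1) = - poly d x" for x
    using assms[of x] by (simp add: d_def algebra_simps add_eq_0_iff)
  have "poly d (x + 2) = poly d x" for x
    using d[of x] d[of "x + 1"] by (simp add: add.assoc)
  hence "d = [:poly d 0:]" by (intro constant_if_shift_invariant[of 2]) auto
  then obtain a where a: "d = [:a:]" by blast
  have "a = 0" using d[of 0] by (simp add: a)
  thus ?thesis using a by (simp add: d_def)
qed

section \<open>Sums of products of Bernoulli and Euler polynomials\<close>

text \<open>The shift by one aligns a sum over constant terms \<open>E\<^sub>j(0)\<close> with a sum over the
  Bernoulli numbers \<open>B\<^sub>l\<close>, where \<open>l = j + 1 \<ge> 2\<close>.\<close>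
lemma sum_split_first:
  fixes h :: "nat \<Rightarrow> complex"
  shows "(\<Sum>j\<le>m. h j) = h 0 + (\<Sum>l=2..Suc m. h (l - 1))"
proof -
  have "(\<Sum>l=2..Suc m. h (l - 1)) = (\<Sum>j=1..m. h j)"
    by (rule sum.reindex_bij_witness[of _ Suc "\<lambda>l. l - 1"]) auto
  moreover have "{..m} = insert 0 {1..m}" by auto
  ultimately show ?thesis by simp
qed

lemma sum_bernoulli_euler:
  "(\<Sum>k=0..n. bernoulli_poly k * euler_poly (n - k))
     = of_nat (n + 1) * euler_poly n
       + (\<Sum>l=2..n. smult (of_nat ((n + 1) choose (l + 1)) * (2 ^ l + of_nat l - 1)
                            * (bernoulli_num l / of_nat l)) (euler_poly (n - l)))"
    (is "?L = ?R")
proof (rule poly_eqI_shift_sum)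
  fix x :: complex
  let ?B = "\<lambda>k. poly (bernoulli_poly k) x" and ?E = "\<lambda>k. poly (euler_poly k) x"
  define a where "a l = of_nat ((n + 1) choose (l + 1)) * (2 ^ l + of_nat l - 1) * (bernoulli_num l / of_nat l)" for l
  have R: "poly ?R y = of_nat (n + 1) * poly (euler_poly n) y + (\<Sum>l=2..n. a l * poly (euler_poly (n - l)) y)" for y
    by (simp add: poly_sum a_def del: binomial_Suc_Suc of_nat_Suc)
  have "poly ?R (x + 1) + poly ?R x = of_nat (n + 1) * (2 * x ^ n) + (\<Sum>l=2..n. 2 * a l * x ^ (n - l))"
    unfolding R euler_poly_plus_1 by (simp add: algebra_simps del: of_nat_Suc of_nat_add flip: sum.distrib)
  also have "\<dots> = poly ?L (x + 1) + poly ?L x"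
  proof (cases n)
    case 0
    thus ?thesis by (simp add: bernoulli_poly_eq_appell euler_poly_eq_appell poly_appell
          bernoulli_num_0 euler_zero_0)
  next
    case n: (Suc m)
    have "poly ?L (x + 1) + poly ?L x
      = (\<Sum>k\<le>n. (?B k + of_nat k * x ^ (k - 1)) * (2 * x ^ (n - k) - ?E (n - k)) + ?B k * ?E (n - k))"
      by (simp add: poly_sum euler_poly_plus_1 bernoulli_poly_plus_1 atLeast0AtMost flip: sum.distrib)
    also have "\<dots> = (\<Sum>k\<le>n. 2 * (x ^ (n - k) * ?B k) + 2 * (of_nat k * x ^ m) - of_nat k * x ^ (k - 1) * ?E (n - k))"
    proof (rule sum.cong[OF refl])
      fix k assume "k \<in> {..n}"
      hence "of_nat k * x ^ (k - 1) * x ^ (n - k) = of_nat k * x ^ m"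
        by (cases k) (auto simp: n simp flip: power_add)
      thus "(?B k + of_nat k * x ^ (k - 1)) * (2 * x ^ (n - k) - ?E (n - k)) + ?B k * ?E (n - k)
          = 2 * (x ^ (n - k) * ?B k) + 2 * (of_nat k * x ^ m) - of_nat k * x ^ (k - 1) * ?E (n - k)"
        by (simp add: algebra_simps)
    qed
    also have "\<dots> = 2 * (\<Sum>k\<le>n. x ^ (n - k) * ?B k) + (2 * (\<Sum>k\<le>n. of_nat k)) * x ^ m
        - (\<Sum>k\<le>n. of_nat k * x ^ (k - 1) * ?E (n - k))"
      by (simp add: sum.distrib sum_subtractf sum_distrib_left sum_distrib_right mult.assoc)
    also have "2 * (\<Sum>k\<le>n. of_nat k) = (of_nat (n * (n + 1)) :: complex)"
      using double_gauss_sum[of n, where ?'a = complex] by (simp add: atLeast0AtMost distrib_left)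
    also have "(\<Sum>k\<le>n. of_nat k * x ^ (k - 1) * ?E (n - k)) = (\<Sum>k\<le>m. of_nat (m + 1 - k) * x ^ (m - k) * ?E k)"
    proof -
      have "(\<Sum>k\<le>n. of_nat k * x ^ (k - 1) * ?E (n - k)) = (\<Sum>k\<le>m. of_nat (Suc k) * x ^ k * ?E (m - k))"
        unfolding n sum.atMost_Suc_shift by simp
      also have "\<dots> = (\<Sum>k\<le>m. of_nat (m + 1 - k) * x ^ (m - k) * ?E k)"
        by (rule sum.reindex_bij_witness[of _ "\<lambda>k. m - k" "\<lambda>k. m - k"]) (auto simp: Suc_diff_le)
      finally show ?thesis .
    qed
    also have "\<dots> = (\<Sum>j\<le>m. of_nat ((m + 2) choose (j + 2)) * euler_zero j * x ^ (m - j))"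
      unfolding euler_poly_eq_appell by (rule sum_weighted_power_appell)
    also have "\<dots> = of_nat ((m + 2) choose 2) * x ^ m
        + (\<Sum>l=2..n. of_nat ((n + 1) choose (l + 1)) * euler_zero (l - 1) * x ^ (n - l))"
      unfolding sum_split_first n by (auto intro!: sum.cong simp: euler_zero_0 numeral_2_eq_2 simp del: binomial_Suc_Suc)
    also have "(\<Sum>k\<le>n. x ^ (n - k) * ?B k) = (\<Sum>j\<le>n. of_nat ((n + 1) choose (j + 1)) * bernoulli_num j * x ^ (n - j))"
      unfolding bernoulli_poly_eq_appell by (rule sum_power_appell)
    also have "\<dots> = of_nat (n + 1) * x ^ n - of_nat ((m + 2) choose 2) * x ^ m / 2
        + (\<Sum>l=2..n. of_nat ((n + 1) choose (l + 1)) * bernoulli_num l * x ^ (n - l))"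
      unfolding n sum.atMost_Suc_shift sum_split_first[of _ m]
      by (auto intro!: sum.cong simp: bernoulli_num_0 bernoulli_num_1 numeral_2_eq_2 simp del: binomial_Suc_Suc of_nat_Suc)
    also have "of_nat (n * (n + 1)) = (2 * of_nat ((m + 2) choose 2) :: complex)"
    proof -
      have "n * (n + 1) = 2 * ((m + 2) choose 2)"
        unfolding choose_two n by simp
      thus ?thesis by (metis of_nat_mult of_nat_numeral)
    qed
    \<comment> \<open>The terms with \<open>x ^ m\<close> cancel because \<open>B\<^sub>1 = - 1 / 2\<close> and \<open>E\<^sub>0(0) = 1\<close>; the other
        terms match by the formula for \<open>E\<^sub>l\<^sub>-\<^sub>1(0)\<close>.\<close>
    finally have "poly ?L (x + 1) + poly ?L x = of_nat (n + 1) * (2 * x ^ n)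
       + (2 * (\<Sum>l=2..n. of_nat ((n + 1) choose (l + 1)) * bernoulli_num l * x ^ (n - l))
          - (\<Sum>l=2..n. of_nat ((n + 1) choose (l + 1)) * euler_zero (l - 1) * x ^ (n - l)))"
      by (simp add: algebra_simps del: binomial_Suc_Suc)
    also have "2 * (\<Sum>l=2..n. of_nat ((n + 1) choose (l + 1)) * bernoulli_num l * x ^ (n - l))
          - (\<Sum>l=2..n. of_nat ((n + 1) choose (l + 1)) * euler_zero (l - 1) * x ^ (n - l))
       = (\<Sum>l=2..n. 2 * a l * x ^ (n - l))"
      unfolding sum_distrib_left sum_subtractf[symmetric]
    proof (rule sum.cong[OF refl])
      fix l assume "l \<in> {2..n}"
      then obtain j where j: "l = Suc j" by (cases l) auto
      show "2 * (of_nat ((n + 1) choose (l + 1)) * bernoulli_num l * x ^ (n - l))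
          - of_nat ((n + 1) choose (l + 1)) * euler_zero (l - 1) * x ^ (n - l) = 2 * a l * x ^ (n - l)"
      proof -
        define b where "b = bernoulli_num (Suc j) / of_nat (Suc j)"
        have "bernoulli_num (Suc j) = of_nat (Suc j) * b"
          by (simp add: b_def del: of_nat_Suc)
        thus ?thesis
          unfolding a_def j diff_Suc_1 euler_zero_eq b_def[symmetric]
          by (simp add: algebra_simps del: of_nat_Suc binomial_Suc_Suc)
      qed
    qed
    finally show ?thesis by simp
  qed
  finally show "poly ?L (x + 1) + poly ?L x = poly ?R (x + 1) + poly ?R x" ..
qed

lemma sum_bernoulli_euler_over_index:
  "(\<Sum>k=1..n. smult (1 / of_nat k) (bernoulli_poly k) * euler_poly (n - k))
     = smult (harm n) (euler_poly n)
       + (\<Sum>l=2..n. smult (of_nat (n choose l) * 2 ^ l * (bernoulli_num l / of_nat l)) (euler_poly (n - l)))"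
    (is "?L = ?R")
proof (rule poly_eqI_shift_sum)
  fix x :: complex
  let ?B = "\<lambda>k. poly (bernoulli_poly k) x" and ?E = "\<lambda>k. poly (euler_poly k) x"
  define a where "a l = of_nat (n choose l) * 2 ^ l * (bernoulli_num l / of_nat l)" for l
  have R: "poly ?R y = harm n * poly (euler_poly n) y + (\<Sum>l=2..n. a l * poly (euler_poly (n - l)) y)" for y
    by (simp add: poly_sum a_def del: binomial_Suc_Suc of_nat_Suc)
  have "poly ?R (x + 1) + poly ?R x = harm n * (2 * x ^ n) + (\<Sum>l=2..n. 2 * a l * x ^ (n - l))"
    unfolding R euler_poly_plus_1 by (simp add: algebra_simps del: of_nat_Suc of_nat_add flip: sum.distrib)
  also have "\<dots> = poly ?L (x + 1) + poly ?L x"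
  proof (cases n)
    case 0
    thus ?thesis by (simp add: harm_def)
  next
    case n: (Suc m)
    have "poly ?L (x + 1) + poly ?L x
      = (\<Sum>k=1..n. (?B k + of_nat k * x ^ (k - 1)) / of_nat k * (2 * x ^ (n - k) - ?E (n - k))
          + ?B k / of_nat k * ?E (n - k))"
      by (simp add: poly_sum euler_poly_plus_1 bernoulli_poly_plus_1 flip: sum.distrib)
    also have "\<dots> = (\<Sum>k=1..n. 2 * (x ^ (n - k) * ?B k / of_nat k) + 2 * x ^ m - x ^ (k - 1) * ?E (n - k))"
    proof (rule sum.cong[OF refl])
      fix k assume k: "k \<in> {1..n}"
      hence "x ^ (k - 1) * x ^ (n - k) = x ^ m"
        by (auto simp: n simp flip: power_add)
      moreover have "(?B k + of_nat k * x ^ (k - 1)) / of_nat k = ?B k / of_nat k + x ^ (k - 1)"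
        using k by (simp add: add_divide_distrib)
      ultimately show "(?B k + of_nat k * x ^ (k - 1)) / of_nat k * (2 * x ^ (n - k) - ?E (n - k))
            + ?B k / of_nat k * ?E (n - k)
          = 2 * (x ^ (n - k) * ?B k / of_nat k) + 2 * x ^ m - x ^ (k - 1) * ?E (n - k)"
        by (simp add: algebra_simps)
    qed
    also have "\<dots> = 2 * (\<Sum>k=1..n. x ^ (n - k) * ?B k / of_nat k) + 2 * of_nat n * x ^ m
        - (\<Sum>k=1..n. x ^ (k - 1) * ?E (n - k))"
      by (simp add: sum.distrib sum_subtractf sum_distrib_left)
    also have "(\<Sum>k=1..n. x ^ (k - 1) * ?E (n - k)) = (\<Sum>k\<le>m. x ^ (m - k) * ?E k)"
      by (rule sum.reindex_bij_witness[of _ "\<lambda>k. n - k" "\<lambda>k. n - k"]) (auto simp: n)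
    also have "\<dots> = (\<Sum>j\<le>m. of_nat ((m + 1) choose (j + 1)) * euler_zero j * x ^ (m - j))"
      unfolding euler_poly_eq_appell by (rule sum_power_appell)
    also have "\<dots> = of_nat n * x ^ m
        + (\<Sum>l=2..n. of_nat (n choose l) * euler_zero (l - 1) * x ^ (n - l))"
      unfolding sum_split_first n by (auto intro!: sum.cong simp: euler_zero_0 simp del: binomial_Suc_Suc)
    also have "(\<Sum>k=1..n. x ^ (n - k) * ?B k / of_nat k)
        = harm n * x ^ n + (\<Sum>l=1..n. of_nat (n choose l) * (bernoulli_num l / of_nat l) * x ^ (n - l))"
      unfolding bernoulli_poly_eq_appell sum_power_appell_over_index by (simp add: bernoulli_num_0)
    also have "(\<Sum>l=1..n. of_nat (n choose l) * (bernoulli_num l / of_nat l) * x ^ (n - l))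
        = - of_nat n * x ^ m / 2 + (\<Sum>l=2..n. of_nat (n choose l) * (bernoulli_num l / of_nat l) * x ^ (n - l))"
    proof -
      have "{1..n} = insert 1 {2..n}" using n by auto
      thus ?thesis by (simp add: bernoulli_num_1 n left_diff_distrib distrib_right
            add_divide_distrib diff_divide_distrib del: binomial_Suc_Suc sum.cl_ivl_Suc)
    qed
    \<comment> \<open>The terms with \<open>x ^ m\<close> cancel because \<open>B\<^sub>1 = - 1 / 2\<close> and \<open>E\<^sub>0(0) = 1\<close>; the other
        terms match by the formula for \<open>E\<^sub>l\<^sub>-\<^sub>1(0)\<close>.\<close>
    finally have "poly ?L (x + 1) + poly ?L x = harm n * (2 * x ^ n)
       + (2 * (\<Sum>l=2..n. of_nat (n choose l) * (bernoulli_num l / of_nat l) * x ^ (n - l))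
          - (\<Sum>l=2..n. of_nat (n choose l) * euler_zero (l - 1) * x ^ (n - l)))"
      by (simp add: algebra_simps del: binomial_Suc_Suc)
    also have "2 * (\<Sum>l=2..n. of_nat (n choose l) * (bernoulli_num l / of_nat l) * x ^ (n - l))
          - (\<Sum>l=2..n. of_nat (n choose l) * euler_zero (l - 1) * x ^ (n - l))
       = (\<Sum>l=2..n. 2 * a l * x ^ (n - l))"
      unfolding sum_distrib_left sum_subtractf[symmetric]
    proof (rule sum.cong[OF refl])
      fix l assume "l \<in> {2..n}"
      then obtain j where j: "l = Suc j" by (cases l) auto
      show "2 * (of_nat (n choose l) * (bernoulli_num l / of_nat l) * x ^ (n - l))
          - of_nat (n choose l) * euler_zero (l - 1) * x ^ (n - l) = 2 * a l * x ^ (n - l)"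
        unfolding a_def j by (simp add: euler_zero_eq[of j] algebra_simps del: of_nat_Suc binomial_Suc_Suc)
    qed
    finally show ?thesis by simp
  qed
  finally show "poly ?L (x + 1) + poly ?L x = poly ?R (x + 1) + poly ?R x" ..
qed

section \<open>Sums of products of Euler polynomials\<close>

text \<open>The difference of the two sides of the identity for products of Euler polynomials.\<close>
definition euler_defect :: "nat \<Rightarrow> complex poly" where
  "euler_defect n = of_nat (n + 2) * (\<Sum>k\<le>n. euler_poly k * euler_poly (n - k))
     - 8 * (\<Sum>l=2..n+2. smult (of_nat ((n + 2) choose l) * (2 ^ l - 1) * (bernoulli_num l / of_nat l))
                               (bernoulli_poly (n + 2 - l)))"

lemma euler_defect_plus_1: "poly (euler_defect n) (x + 1) = poly (euler_defect n) x"
proof -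
  let ?E = "\<lambda>k. poly (euler_poly k) x"
  define S where "S = (\<Sum>k\<le>n. euler_poly k * euler_poly (n - k))"
  define a where "a l = of_nat ((n + 2) choose l) * (2 ^ l - 1) * (bernoulli_num l / of_nat l)" for l
  define R where "R = (\<Sum>l=2..n+2. smult (a l) (bernoulli_poly (n + 2 - l)))"
  have "poly S (x + 1) - poly S x = (\<Sum>k\<le>n. (2 * x ^ k - ?E k) * (2 * x ^ (n - k) - ?E (n - k)) - ?E k * ?E (n - k))"
    by (simp add: S_def poly_sum euler_poly_plus_1 flip: sum_subtractf)
  also have "\<dots> = (\<Sum>k\<le>n. 4 * x ^ n - 2 * (x ^ (n - k) * ?E k) - 2 * (x ^ k * ?E (n - k)))"
  proof (rule sum.cong[OF refl])
    fix k assume "k \<in> {..n}"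
    hence "x ^ k * x ^ (n - k) = x ^ n" by (simp flip: power_add)
    thus "(2 * x ^ k - ?E k) * (2 * x ^ (n - k) - ?E (n - k)) - ?E k * ?E (n - k)
        = 4 * x ^ n - 2 * (x ^ (n - k) * ?E k) - 2 * (x ^ k * ?E (n - k))"
      by (simp add: algebra_simps)
  qed
  also have "\<dots> = 4 * of_nat (n + 1) * x ^ n - 2 * (\<Sum>k\<le>n. x ^ (n - k) * ?E k) - 2 * (\<Sum>k\<le>n. x ^ k * ?E (n - k))"
    by (simp add: sum_subtractf sum_distrib_left)
  also have "(\<Sum>k\<le>n. x ^ k * ?E (n - k)) = (\<Sum>k\<le>n. x ^ (n - k) * ?E k)"
    by (rule sum.reindex_bij_witness[of _ "\<lambda>k. n - k" "\<lambda>k. n - k"]) auto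
  also have "(\<Sum>k\<le>n. x ^ (n - k) * ?E k) = (\<Sum>j\<le>n. of_nat ((n + 1) choose (j + 1)) * euler_zero j * x ^ (n - j))"
    unfolding euler_poly_eq_appell by (rule sum_power_appell)
  also have "\<dots> = of_nat (n + 1) * x ^ n + (\<Sum>l=2..Suc n. of_nat ((n + 1) choose l) * euler_zero (l - 1) * x ^ (n + 1 - l))"
    unfolding sum_split_first by (auto intro!: sum.cong simp: euler_zero_0 simp del: binomial_Suc_Suc)
  finally have S: "poly S (x + 1) - poly S x
      = - 4 * (\<Sum>l=2..Suc n. of_nat ((n + 1) choose l) * euler_zero (l - 1) * x ^ (n + 1 - l))"
    by (simp add: algebra_simps del: binomial_Suc_Suc sum.cl_ivl_Suc)
  have "poly R (x + 1) - poly R x = (\<Sum>l=2..n+2. a l * (of_nat (n + 2 - l) * x ^ (n + 1 - l)))"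
    by (simp add: R_def poly_sum bernoulli_poly_plus_1 distrib_left sum.distrib del: sum.cl_ivl_Suc)
  also have "\<dots> = (\<Sum>l=2..Suc n. a l * (of_nat (n + 2 - l) * x ^ (n + 1 - l)))"
    by (simp add: Suc_diff_le cong: sum.cong)
  also have "8 * \<dots> = of_nat (n + 2)
      * (- 4 * (\<Sum>l=2..Suc n. of_nat ((n + 1) choose l) * euler_zero (l - 1) * x ^ (n + 1 - l)))"
    unfolding sum_distrib_left
  proof (rule sum.cong[OF refl])
    fix l assume l: "l \<in> {2..Suc n}"
    then obtain j where j: "l = Suc j" by (cases l) auto
    have "(n + 2 - l) * ((n + 2) choose l) = (n + 2) * ((n + 1) choose l)"
      using binomial_absorb_comp[of "n + 2" l] by simp
    hence c: "of_nat ((n + 2) choose l) * of_nat (n + 2 - l) = (of_nat (n + 2) * of_nat ((n + 1) choose l) :: complex)"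
      by (metis mult.commute of_nat_mult)
    have "8 * (a l * (of_nat (n + 2 - l) * x ^ (n + 1 - l)))
        = (of_nat ((n + 2) choose l) * of_nat (n + 2 - l)) 
          * (8 * (2 ^ l - 1) * (bernoulli_num l / of_nat l)) * x ^ (n + 1 - l)"
      unfolding a_def by (simp only: mult_ac)
    also have "8 * (2 ^ l - 1) * (bernoulli_num l / of_nat l) = - 4 * euler_zero (l - 1)"
      unfolding j by (simp add: euler_zero_eq[of j] algebra_simps del: of_nat_Suc)
    finally show "8 * (a l * (of_nat (n + 2 - l) * x ^ (n + 1 - l)))
        = of_nat (n + 2) * (- 4 * (of_nat ((n + 1) choose l) * euler_zero (l - 1) * x ^ (n + 1 - l)))"
      unfolding c by (simp only: mult_ac)
  qed
  finally have "8 * (poly R (x + 1) - poly R x) = of_nat (n + 2) * (poly S (x + 1) - poly S x)"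
    by (simp only: S)
  hence RS: "of_nat (n + 2) * poly S (x + 1) - 8 * poly R (x + 1) = of_nat (n + 2) * poly S x - 8 * poly R x"
    by (simp add: right_diff_distrib diff_eq_eq del: of_nat_add)
  have D: "poly (euler_defect n) y = of_nat (n + 2) * poly S y - 8 * poly R y" for y
    by (simp add: euler_defect_def S_def R_def a_def del: sum.cl_ivl_Suc of_nat_Suc)
  show ?thesis
    unfolding D by (fact RS)
qed

lemma smult_sum_right: "smult a (sum f A) = (\<Sum>x\<in>A. smult a (f x))" for a :: complex
  by (induction A rule: infinite_finite_induct) (simp_all add: smult_add_right)

lemma pderiv_euler_defect:
  "pderiv (euler_defect (Suc n)) = smult (of_nat (n + 3)) (euler_defect n)"
proof -
  define S where "S n = (\<Sum>k\<le>n. euler_poly k * euler_poly (n - k))" for n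
  define R where "R n = (\<Sum>l=2..n+2. smult (of_nat ((n + 2) choose l) * (2 ^ l - 1) * (bernoulli_num l / of_nat l))
                               (bernoulli_poly (n + 2 - l)))" for n
  have dE: "pderiv (euler_poly k) = smult (of_nat k) (euler_poly (k - 1))" for k
    by (cases k) (simp_all add: euler_poly_eq_appell pderiv_appell, simp add: appell_poly_def monom_0)
  have dB: "pderiv (bernoulli_poly k) = smult (of_nat k) (bernoulli_poly (k - 1))" for k
    by (cases k) (simp_all add: bernoulli_poly_eq_appell pderiv_appell, simp add: appell_poly_def monom_0)
  have "pderiv (S (Suc n)) = (\<Sum>k\<le>Suc n. smult (of_nat (Suc n - k)) (euler_poly k * euler_poly (n - k)))
      + (\<Sum>k\<le>Suc n. smult (of_nat k) (euler_poly (Suc n - k) * euler_poly (k - 1)))"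
    unfolding S_def pderiv_sum by (simp add: pderiv_mult dE sum.distrib del: sum.atMost_Suc of_nat_Suc)
  also have "(\<Sum>k\<le>Suc n. smult (of_nat k) (euler_poly (Suc n - k) * euler_poly (k - 1)))
      = (\<Sum>k\<le>n. smult (of_nat (Suc k)) (euler_poly k * euler_poly (n - k)))"
    unfolding sum.atMost_Suc_shift by (simp add: mult.commute del: of_nat_Suc)
  also have "(\<Sum>k\<le>Suc n. smult (of_nat (Suc n - k)) (euler_poly k * euler_poly (n - k)))
      = (\<Sum>k\<le>n. smult (of_nat (Suc n - k)) (euler_poly k * euler_poly (n - k)))"
    by simp
  also have "\<dots> + (\<Sum>k\<le>n. smult (of_nat (Suc k)) (euler_poly k * euler_poly (n - k))) = smult (of_nat (n + 2)) (S n)"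
    unfolding S_def smult_sum_right sum.distrib[symmetric] smult_add_left[symmetric] of_nat_add[symmetric]
    by (rule sum.cong) auto
  finally have S: "pderiv (S (Suc n)) = smult (of_nat (n + 2)) (S n)" .
  have "pderiv (R (Suc n)) = (\<Sum>l=2..n+3. smult (of_nat (n + 3 - l) * of_nat ((n + 3) choose l)
            * (2 ^ l - 1) * (bernoulli_num l / of_nat l))
                               (bernoulli_poly (n + 2 - l)))"
    unfolding R_def pderiv_sum by (simp add: pderiv_smult dB mult_ac numeral_3_eq_3
          del: sum.cl_ivl_Suc of_nat_Suc binomial_Suc_Suc)
  also have "\<dots> = (\<Sum>l=2..n+2. smult (of_nat (n + 3 - l) * of_nat ((n + 3) choose l)
            * (2 ^ l - 1) * (bernoulli_num l / of_nat l))
                               (bernoulli_poly (n + 2 - l)))"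
    by (simp add: numeral_3_eq_3 del: of_nat_Suc binomial_Suc_Suc)
  also have "\<dots> = smult (of_nat (n + 3)) (R n)"
    unfolding R_def smult_sum_right
  proof (rule sum.cong[OF refl])
    fix l
    have "(n + 3 - l) * ((n + 3) choose l) = (n + 3) * ((n + 2) choose l)"
      using binomial_absorb_comp[of "n + 3" l] by simp
    hence c: "of_nat (n + 3 - l) * of_nat ((n + 3) choose l) = (of_nat (n + 3) * of_nat ((n + 2) choose l) :: complex)"
      by (metis of_nat_mult)
    show "smult (of_nat (n + 3 - l) * of_nat ((n + 3) choose l)
            * (2 ^ l - 1) * (bernoulli_num l / of_nat l)) (bernoulli_poly (n + 2 - l))
      = smult (of_nat (n + 3)) (smult (of_nat ((n + 2) choose l) * (2 ^ l - 1)
            * (bernoulli_num l / of_nat l)) (bernoulli_poly (n + 2 - l)))"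
      unfolding c smult_smult by (simp only: mult.assoc)
  qed
  finally have R: "pderiv (R (Suc n)) = smult (of_nat (n + 3)) (R n)" .
  have D: "euler_defect n = smult (of_nat (n + 2)) (S n) - smult 8 (R n)" for n
    by (simp add: euler_defect_def S_def R_def of_nat_poly numeral_poly del: sum.cl_ivl_Suc of_nat_Suc)
  show ?thesis
    unfolding D by (simp add: pderiv_diff pderiv_smult S R smult_diff_right mult_ac numeral_3_eq_3
          del: of_nat_Suc)
qed

text \<open>Shift invariance at \<open>n + 1\<close> gives a constant, whose derivative is a nonzero multiple of the
  defect at \<open>n\<close>.\<close>
lemma euler_defect_eq_0: "euler_defect n = 0"
proof -
  have "euler_defect (Suc n) = [:poly (euler_defect (Suc n)) 0:]"
    by (rule constant_if_shift_invariant[of 1]) (simp_all add: euler_defect_plus_1)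
  hence "pderiv (euler_defect (Suc n)) = 0"
    by (metis pderiv_singleton)
  thus ?thesis by (simp add: pderiv_euler_defect del: of_nat_add of_nat_Suc)
qed

theorem corollary1p3:
  fixes n :: nat
  shows
    "(of_nat (n + 2) * (\<Sum>k=0..n. euler_poly k * euler_poly (n - k)) =
        8 * (\<Sum>l=2..n+2. smult (of_nat ((n + 2) choose l) * (2 ^ l - 1) * (bernoulli_num l / of_nat l))
                               (bernoulli_poly (n + 2 - l)))) \<and>
     ((\<Sum>k=1..n. smult (1 / of_nat k) (bernoulli_poly k) * euler_poly (n - k))
        - (\<Sum>l=2..n. smult (of_nat (n choose l) * 2 ^ l * (bernoulli_num l / of_nat l))
                             (euler_poly (n - l))) =
        smult (harm n) (euler_poly n)) \<and>
     ((\<Sum>k=0..n. bernoulli_poly k * euler_poly (n - k))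
        - (\<Sum>l=2..n. smult (of_nat ((n + 1) choose (l + 1)) * (2 ^ l + of_nat l - 1)
                               * (bernoulli_num l / of_nat l))
                             (euler_poly (n - l))) =
        of_nat (n + 1) * euler_poly n)"
  using euler_defect_eq_0[of n] sum_bernoulli_euler_over_index[of n] sum_bernoulli_euler[of n]
  unfolding euler_defect_def atLeast0AtMost by simp

end
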